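(* Let $f:\mathbb{R}^n\to\mathbb{R}$ be twice continuously differentiable and level-bounded, and let $f_\star=\inf f$. Let $\phi:\mathbb{R}^n\to\mathbb{R}\cup\{+\infty\}$ be proper, lower semicontinuous, essentially smooth and strongly convex with constant $\mu_\phi>0$, and suppose moreover that $\phi\ge 0$, $\phi$ is even, and $\phi(0)=0$. Let $x_0\in\mathbb{R}^n$ and let $x:[0,\infty)\to\mathbb{R}^n$ be the unique solution of $$\dot x(t)=-\nabla\phi^*(\nabla f(x(t))),\qquad x(0)=x_0.$$ Suppose there exists $\mu>0$ such that for all $z\in\mathbb{R}^n$, $$\phi(\nabla\phi^*(\nabla f(z)))\ge\mu\,(f(z)-f_\star).$$ Then, for all $t\ge 0$, $$f(x(t))-f_\star\le\exp(-\mu t)\,(f(x_0)-f_\star).$$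
   Context: $\|\cdot\|$ and $\langle\cdot,\cdot\rangle$ are the Euclidean norm and inner product on $\mathbb{R}^n$. $\phi^*(y)=\sup_x\{\langle x,y\rangle-\phi(x)\}$ is the convex conjugate; under the assumptions $\phi^*$ is finite and differentiable on $\mathbb{R}^n$ with $1/\mu_\phi$-Lipschitz gradient, and the differential equation has a unique global solution on $[0,\infty)$ for each $x_0$. $f$ is level-bounded if $\{x\in\mathbb{R}^n\mid f(x)\le\alpha\}$ is bounded for every $\alpha\in\mathbb{R}$. $\phi$ is even if $\phi(-x)=\phi(x)$ for all $x$. A proper, lower semicontinuous, convex function $\phi$ is essentially smooth if $\operatorname{int}(\operatorname{dom}\phi)\neq\emptyset$, $\phi$ is differentiable on $\operatorname{int}(\operatorname{dom}\phi)$, and $\|\nabla\phi(x^\nu)\|\to\infty$ whenever $\operatorname{int}(\operatorname{dom}\phi)\ni x^\nu\to x\in\operatorname{bdry}\operatorname{dom}\phi$, where $\operatorname{dom}\phi=\{x\mid\phi(x)<\infty\}$. *)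

theory Defs
  imports "HOL-Analysis.Analysis"
begin

definition gradient :: "('a::euclidean_space \<Rightarrow> real) \<Rightarrow> 'a \<Rightarrow> 'a" where
  "gradient f x = (THE D. GDERIV f x :> D)"

definition C2_function :: "('a::euclidean_space \<Rightarrow> real) \<Rightarrow> bool" where
  "C2_function f \<longleftrightarrow>
    (\<exists>(g :: 'a \<Rightarrow> 'a) (H :: 'a \<Rightarrow> 'a \<Rightarrow>\<^sub>L 'a).
      (\<forall>x. GDERIV f x :> g x) \<and>
      (\<forall>x. (g has_derivative blinfun_apply (H x)) (at x)) \<and>
      continuous_on UNIV H)"

definition level_bounded :: "('a::euclidean_space \<Rightarrow> real) \<Rightarrow> bool" where
  "level_bounded f \<longleftrightarrow> (\<forall>\<alpha>. bounded {x. f x \<le> \<alpha>})"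

definition edom :: "('a \<Rightarrow> ereal) \<Rightarrow> 'a set" where
  "edom \<phi> = {x. \<phi> x < \<infinity>}"

definition proper_fun :: "('a \<Rightarrow> ereal) \<Rightarrow> bool" where
  "proper_fun \<phi> \<longleftrightarrow> (\<forall>x. \<phi> x \<noteq> -\<infinity>) \<and> (\<exists>x. \<phi> x < \<infinity>)"

definition lsc :: "('a::topological_space \<Rightarrow> ereal) \<Rightarrow> bool" where
  "lsc \<phi> \<longleftrightarrow> (\<forall>x. \<phi> x \<le> Liminf (at x) \<phi>)"

text \<open>
  The quadratic term is kept on the left-hand side so that no subtraction of extended
  reals occurs; for \<open>m = 0\<close> this is convexity of \<open>\<phi>\<close>.
\<close>
definition strongly_convex :: "real \<Rightarrow> ('a::euclidean_space \<Rightarrow> ereal) \<Rightarrow> bool" where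
  "strongly_convex m \<phi> \<longleftrightarrow>
    (\<forall>x y. \<forall>s\<in>{0<..<1}.
      \<phi> ((1 - s) *\<^sub>R x + s *\<^sub>R y) + ereal (m / 2 * s * (1 - s) * (norm (x - y))\<^sup>2)
        \<le> ereal (1 - s) * \<phi> x + ereal s * \<phi> y)"

text \<open>
  Differentiability of an extended-real-valued function at a point requires finiteness in
  a neighbourhood; without it, \<open>real_of_ereal\<close> (which sends infinite values to 0) could
  create spurious derivatives.
\<close>
definition has_egradient :: "('a::euclidean_space \<Rightarrow> ereal) \<Rightarrow> 'a \<Rightarrow> 'a \<Rightarrow> bool" where
  "has_egradient \<phi> x D \<longleftrightarrow>
    x \<in> interior {z. \<bar>\<phi> z\<bar> \<noteq> \<infinity>} \<and> GDERIV (\<lambda>z. real_of_ereal (\<phi> z)) x :> D"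

definition egradient :: "('a::euclidean_space \<Rightarrow> ereal) \<Rightarrow> 'a \<Rightarrow> 'a" where
  "egradient \<phi> x = (THE D. has_egradient \<phi> x D)"

text \<open>Used only for functions that are proper, lower semicontinuous and convex.\<close>
definition essentially_smooth :: "('a::euclidean_space \<Rightarrow> ereal) \<Rightarrow> bool" where
  "essentially_smooth \<phi> \<longleftrightarrow>
    interior (edom \<phi>) \<noteq> {} \<and>
    (\<forall>x\<in>interior (edom \<phi>). \<exists>D. has_egradient \<phi> x D) \<and>
    (\<forall>X x. (\<forall>k::nat. X k \<in> interior (edom \<phi>)) \<and> X \<longlonglongrightarrow> x \<and> x \<in> frontier (edom \<phi>)
      \<longrightarrow> filterlim (\<lambda>k. norm (egradient \<phi> (X k))) at_top sequentially)"

definition conjugate :: "('a::euclidean_space \<Rightarrow> ereal) \<Rightarrow> 'a \<Rightarrow> ereal" where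
  "conjugate \<phi> y = (SUP x. ereal (x \<bullet> y) - \<phi> x)"

definition preconditioned_flow ::
    "('a::euclidean_space \<Rightarrow> real) \<Rightarrow> ('a \<Rightarrow> ereal) \<Rightarrow> 'a \<Rightarrow> (real \<Rightarrow> 'a) \<Rightarrow> bool" where
  "preconditioned_flow f \<phi> x0 x \<longleftrightarrow>
    x 0 = x0 \<and>
    (\<forall>t\<ge>0. (x has_vector_derivative - egradient (conjugate \<phi>) (gradient f (x t)))
      (at t within {0..}))"

end

theory Submission
  imports Defs
begin

text \<open>
  Strong convexity makes the supremum defining \<open>\<phi>\<^sup>*(y)\<close> attained at a single point, and that point
  is the gradient of \<open>\<phi>\<^sup>*\<close> at \<open>y\<close>. Hence \<open>\<langle>\<nabla>\<phi>\<^sup>*(y), y\<rangle> = \<phi>(\<nabla>\<phi>\<^sup>*(y)) + \<phi>\<^sup>*(y) \<ge> \<phi>(\<nabla>\<phi>\<^sup>*(y))\<close>, since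
  \<open>\<phi>(0) = 0\<close> gives \<open>\<phi>\<^sup>* \<ge> 0\<close>. Along the flow this bounds the derivative of \<open>f(x(t))\<close> by
  \<open>-\<mu> (f(x(t)) - f\<^sub>\<star>)\<close>, and Gronwall's argument applies.
\<close>

text \<open>Lets the definite descriptions in \<open>gradient\<close> and \<open>egradient\<close>
  be evaluated from any witness.\<close>

lemma GDERIV_unique:
  assumes "GDERIV f x :> D" and "GDERIV f x :> E"
  shows "D = E"
proof -
  have "(\<lambda>h. h \<bullet> D) = (\<lambda>h. h \<bullet> E)"
    using assms has_derivative_unique unfolding gderiv_def by blast
  then show ?thesis by (metis inner_commute vector_eq_rdot)
qed

lemma gradient_eq: "GDERIV f x :> D \<Longrightarrow> gradient f x = D"
  unfolding gradient_def by (blast intro: GDERIV_unique)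

lemma egradient_eq: "has_egradient \<phi> x D \<Longrightarrow> egradient \<phi> x = D"
  unfolding egradient_def has_egradient_def by (blast intro: GDERIV_unique)

text \<open>A real \<open>a\<close> strictly between \<open>l x\<close> and \<open>\<phi> x\<close>
  separates the two near \<open>x\<close>: lower semicontinuity keeps \<phi> above \<open>a\<close>,
  continuity keeps \<open>l\<close> below it.\<close>

lemma lsc_imp_open_superlevel:
  fixes \<phi> :: "'a::topological_space \<Rightarrow> ereal"
  assumes "lsc \<phi>" and l: "continuous_on UNIV l"
  shows "open {x. ereal (l x) < \<phi> x}"
proof (subst open_subopen, safe)
  fix x assume "ereal (l x) < \<phi> x"
  then obtain a where a: "l x < a" "ereal a < \<phi> x"
    using ereal_dense2 by force
  have "\<phi> x \<le> Liminf (at x) \<phi>" using assms(1) by (simp add: lsc_def)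
  with a(2) have "\<forall>\<^sub>F z in at x. ereal a < \<phi> z" by (simp add: le_Liminf_iff)
  \<comment> \<open>The \<open>Liminf\<close> ignores \<open>x\<close> itself, so the value there is
    supplied separately.\<close>
  with a(2) have "\<forall>\<^sub>F z in nhds x. ereal a < \<phi> z" by (simp add: eventually_nhds_conv_at)
  moreover have "\<forall>\<^sub>F z in nhds x. z \<in> {z. l z < a}"
    using l a(1) by (intro eventually_nhds_in_open open_Collect_less) auto
  ultimately have "\<forall>\<^sub>F z in nhds x. ereal (l z) < \<phi> z"
    by eventually_elim (auto intro: less_trans[of _ "ereal a"])
  then show "\<exists>T. open T \<and> x \<in> T \<and> T \<subseteq> {x. ereal (l x) < \<phi> x}"
    unfolding eventually_nhds by blast
qed

text \<open>
  The conclusion says that \<open>p\<close> minimises \<open>\<phi> - l\<close> over \<open>K\<close>; comparing through real \<open>c\<close> avoids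
  subtraction of extended reals.
\<close>
lemma lsc_attains_min_on_compact:
  fixes \<phi> :: "'a::topological_space \<Rightarrow> ereal"
  assumes "lsc \<phi>" and "compact K" and "K \<noteq> {}" and l: "continuous_on UNIV l"
  obtains p where "p \<in> K" and "\<And>q c. q \<in> K \<Longrightarrow> \<phi> q < ereal (c + l q) \<Longrightarrow> \<phi> p \<le> ereal (c + l p)"
proof -
  define C where "C = {c. \<exists>q\<in>K. \<phi> q < ereal (c + l q)}"
  have "\<exists>p\<in>K. \<forall>c\<in>C. \<phi> p \<le> ereal (c + l p)"
  proof (rule ccontr)
    assume "\<not> ?thesis"
    then have cover: "K \<subseteq> (\<Union>c\<in>C. {x. ereal (c + l x) < \<phi> x})" by (force simp: not_le)
    have "open {x. ereal (c + l x) < \<phi> x}" for c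
      using l by (intro lsc_imp_open_superlevel assms continuous_intros)
    then obtain D where D: "D \<subseteq> C" "finite D" "K \<subseteq> (\<Union>c\<in>D. {x. ereal (c + l x) < \<phi> x})"
      by (rule compactE_image[OF assms(2) _ cover])
    with assms(3) have "D \<noteq> {}" by auto
    \<comment> \<open>The least level in the finite subcover is still in \<open>C\<close>, so some
      \<open>q\<close> in \<open>K\<close> lies strictly below it; no level in \<open>D\<close> is
      smaller, so \<open>q\<close> is not covered.\<close>
    with D(1,2) have "Min D \<in> C" using Min_in by blast
    then obtain q where q: "q \<in> K" "\<phi> q < ereal (Min D + l q)"
      unfolding C_def by blast
    with D(3) obtain c where c: "c \<in> D" "ereal (c + l q) < \<phi> q" by blast
    with D(2) have "ereal (Min D + l q) \<le> ereal (c + l q)" by simp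
    with q(2) have "\<phi> q < ereal (c + l q)" by (rule less_le_trans)
    with c(2) show False by simp
  qed
  then obtain p where "p \<in> K" "\<forall>c\<in>C. \<phi> p \<le> ereal (c + l p)" by blast
  then show ?thesis by (intro that[of p]) (auto simp: C_def)
qed

text \<open>Bound \<phi> at \<open>(1 - s) *\<^sub>R p + s *\<^sub>R x\<close> from below by the
  subgradient inequality and from above by strong convexity, divide by \<open>s\<close>, and let
  \<open>s\<close> tend to 0 from the right.\<close>

lemma strongly_convex_subgradient_growth:
  fixes \<phi> :: "'a::euclidean_space \<Rightarrow> ereal"
  assumes sc: "strongly_convex m \<phi>" and p: "\<phi> p = ereal r"
    and sub: "\<And>x. ereal (r + (x - p) \<bullet> y) \<le> \<phi> x"
  shows "ereal (r + (x - p) \<bullet> y + m / 2 * (norm (x - p))\<^sup>2) \<le> \<phi> x"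
proof (cases "\<phi> x")
  case (real R)
  have ineq: "r + (x - p) \<bullet> y + m / 2 * (1 - s) * (norm (x - p))\<^sup>2 \<le> R" if s: "s \<in> {0<..<1}" for s
  proof -
    have "(1 - s) *\<^sub>R p + s *\<^sub>R x - p = s *\<^sub>R (x - p)" by (simp add: algebra_simps)
    then have "ereal (r + s * ((x - p) \<bullet> y)) \<le> \<phi> ((1 - s) *\<^sub>R p + s *\<^sub>R x)"
      using sub[of "(1 - s) *\<^sub>R p + s *\<^sub>R x"] by simp
    then have "ereal (r + s * ((x - p) \<bullet> y)) + ereal (m / 2 * s * (1 - s) * (norm (p - x))\<^sup>2)
        \<le> \<phi> ((1 - s) *\<^sub>R p + s *\<^sub>R x) + ereal (m / 2 * s * (1 - s) * (norm (p - x))\<^sup>2)"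
      by (rule add_right_mono)
    also have "\<dots> \<le> ereal (1 - s) * \<phi> p + ereal s * \<phi> x"
      using sc s unfolding strongly_convex_def by blast
    finally have "s * (r + (x - p) \<bullet> y + m / 2 * (1 - s) * (norm (x - p))\<^sup>2) \<le> s * R"
      by (simp add: p real norm_minus_commute algebra_simps)
    with s show ?thesis by simp
  qed
  have "((\<lambda>s. r + (x - p) \<bullet> y + m / 2 * (1 - s) * (norm (x - p))\<^sup>2)
      \<longlongrightarrow> r + (x - p) \<bullet> y + m / 2 * (1 - 0) * (norm (x - p))\<^sup>2) (at_right 0)"
    by (intro tendsto_intros)
  moreover have "\<forall>\<^sub>F s in at_right 0. r + (x - p) \<bullet> y + m / 2 * (1 - s) * (norm (x - p))\<^sup>2 \<le> R"
    unfolding eventually_at_right_field by (rule exI[of _ 1]) (use ineq in auto)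
  ultimately have "r + (x - p) \<bullet> y + m / 2 * (1 - 0) * (norm (x - p))\<^sup>2 \<le> R"
    by (rule tendsto_upperbound) simp
  then show ?thesis by (simp add: real)
qed (use sub[of x] in auto)

text \<open>A minimiser \<open>p\<close> of \<phi> minus the linear form of \<open>y\<close> has
  \<open>y\<close> as a subgradient. Quadratic growth reduces the search for it to a compact
  ball.\<close>

lemma subgradient_surj:
  fixes \<phi> :: "'a::euclidean_space \<Rightarrow> ereal"
  assumes "lsc \<phi>" and m: "m > 0" and sc: "strongly_convex m \<phi>"
    and nonneg: "\<And>x. \<phi> x \<ge> 0" and zero: "\<phi> 0 = 0"
  obtains p r where "\<phi> p = ereal r" and "\<And>x. ereal (r + (x - p) \<bullet> y) \<le> \<phi> x"
proof -
  \<comment> \<open>Since \<phi> is nonnegative and vanishes at 0, the zero vector is a subgradient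
    there.\<close>
  have growth: "ereal (m / 2 * (norm x)\<^sup>2) \<le> \<phi> x" for x
    using strongly_convex_subgradient_growth[OF sc, of 0 0 0 x] nonneg zero
    by (simp add: zero_ereal_def)
  \<comment> \<open>Outside this radius \<open>m / 2 * (norm x)\<^sup>2\<close> dominates
    \<open>x \<bullet> y\<close>, so the objective is no smaller than its value 0 at the origin,
    which lies in \<open>K\<close>.\<close>
  define K where "K = cball (0::'a) (2 * norm y / m)"
  have K: "compact K" "K \<noteq> {}" "0 \<in> K" using m by (auto simp: K_def divide_less_0_iff)
  obtain p where "p \<in> K"
    and p: "\<And>q c. q \<in> K \<Longrightarrow> \<phi> q < ereal (c + q \<bullet> y) \<Longrightarrow> \<phi> p \<le> ereal (c + p \<bullet> y)"
    using lsc_attains_min_on_compact[OF assms(1) K(1,2), of "\<lambda>x. x \<bullet> y"]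
      continuous_on_inner[OF continuous_on_id continuous_on_const]
    by blast
  have "\<phi> p \<le> ereal (1 + p \<bullet> y)" using p[OF K(3), of 1] zero by simp
  with nonneg[of p] obtain r where r: "\<phi> p = ereal r" by (cases "\<phi> p") auto
  have inside: "ereal (r + (x - p) \<bullet> y) \<le> \<phi> x" if "x \<in> K" for x
  proof (rule ccontr)
    assume "\<not> ?thesis"
    then obtain z where z: "\<phi> x < ereal z" "z < r + (x - p) \<bullet> y"
      using ereal_dense2[of "\<phi> x" "ereal (r + (x - p) \<bullet> y)"] by (auto simp: not_le)
    with p[OF that, of "z - x \<bullet> y"] r show False by (simp add: inner_diff_left)
  qed
  have "ereal (r + (x - p) \<bullet> y) \<le> \<phi> x" if "x \<notin> K" for x
  proof -
    have "r \<le> p \<bullet> y" using inside[OF K(3)] zero by (simp add: zero_ereal_def)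
    moreover have "x \<bullet> y \<le> norm x * norm y" by (rule norm_cauchy_schwarz)
    moreover have "norm x * norm y \<le> norm x * (m / 2 * norm x)"
      using that m by (intro mult_left_mono) (auto simp: K_def field_simps)
    ultimately have "r + (x - p) \<bullet> y \<le> m / 2 * (norm x)\<^sup>2"
      by (simp add: inner_diff_left power2_eq_square algebra_simps)
    then show ?thesis using growth[of x] by (meson ereal_less_eq(3) order_trans)
  qed
  with inside r that show ?thesis by blast
qed

text \<open>The equality case of Fenchel-Young: the subgradient inequality says that
  \<open>p\<close> attains the supremum.\<close>

lemma conjugate_at_subgradient:
  assumes p: "\<phi> p = ereal r" and sub: "\<And>x. ereal (r + (x - p) \<bullet> y) \<le> \<phi> x"
  shows "conjugate \<phi> y = ereal (p \<bullet> y - r)"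
  unfolding conjugate_def
proof (rule antisym)
  show "(SUP x. ereal (x \<bullet> y) - \<phi> x) \<le> ereal (p \<bullet> y - r)"
  proof (rule SUP_least)
    fix x
    show "ereal (x \<bullet> y) - \<phi> x \<le> ereal (p \<bullet> y - r)"
      using sub[of x] by (cases "\<phi> x") (auto simp: inner_diff_left)
  qed
  show "ereal (p \<bullet> y - r) \<le> (SUP x. ereal (x \<bullet> y) - \<phi> x)"
    using p by (intro SUP_upper2[of p]) auto
qed

text \<open>The conjugate is squeezed between an affine function with slope \<open>p\<close> and the
  same function plus a quadratic in \<open>z - y\<close>. The two bounds agree at \<open>y\<close>,
  which forces the gradient \<open>p\<close>.\<close>

lemma has_egradient_conjugate:
  fixes \<phi> :: "'a::euclidean_space \<Rightarrow> ereal"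
  assumes m: "m > 0" and sc: "strongly_convex m \<phi>"
    and p: "\<phi> p = ereal r" and sub: "\<And>x. ereal (r + (x - p) \<bullet> y) \<le> \<phi> x"
  shows "has_egradient (conjugate \<phi>) y p"
proof -
  have lower: "ereal (p \<bullet> z - r) \<le> conjugate \<phi> z" for z
    unfolding conjugate_def using p by (intro SUP_upper2[of p]) auto
  have upper: "conjugate \<phi> z \<le> ereal (p \<bullet> z - r + (norm (z - y))\<^sup>2 / (2 * m))" for z
    unfolding conjugate_def
  proof (rule SUP_least)
    fix x
    have expand: "(norm (m *\<^sub>R u - v))\<^sup>2 = m\<^sup>2 * (norm u)\<^sup>2 - 2 * m * (u \<bullet> v) + (norm v)\<^sup>2"
      for u v :: 'a
      unfolding power2_norm_eq_inner
      by (simp add: inner_diff inner_commute power2_eq_square algebra_simps)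
    \<comment> \<open>Completing the square: this is Young's inequality for \<open>x - p\<close> and
      \<open>z - y\<close> with weight \<open>m\<close>, so the strong convexity term absorbs the
      part of the cross term that grows with \<open>x\<close>.\<close>
    have "0 \<le> (norm (m *\<^sub>R (x - p) - (z - y)))\<^sup>2 / (2 * m)" using m by simp
    also have "\<dots> = m / 2 * (norm (x - p))\<^sup>2 - (x - p) \<bullet> (z - y) + (norm (z - y))\<^sup>2 / (2 * m)"
      unfolding expand using m by (simp add: field_simps power2_eq_square)
    finally have "x \<bullet> z - (r + (x - p) \<bullet> y + m / 2 * (norm (x - p))\<^sup>2)
        \<le> p \<bullet> z - r + (norm (z - y))\<^sup>2 / (2 * m)"
      by (simp add: inner_diff algebra_simps)
    then show "ereal (x \<bullet> z) - \<phi> x \<le> ereal (p \<bullet> z - r + (norm (z - y))\<^sup>2 / (2 * m))"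
      using strongly_convex_subgradient_growth[OF sc p sub, of x] by (cases "\<phi> x") auto
  qed
  have fin: "\<bar>conjugate \<phi> z\<bar> \<noteq> \<infinity>" for z
    using lower[of z] upper[of z] by (cases "conjugate \<phi> z") auto
  define k where "k z = real_of_ereal (conjugate \<phi> z)" for z
  have k: "conjugate \<phi> z = ereal (k z)" for z
    using fin[of z] by (simp add: k_def ereal_real)
  have ky: "k y = p \<bullet> y - r"
    using conjugate_at_subgradient[of \<phi> p r y] p sub by (simp add: k_def)
  have "(k has_derivative (\<lambda>h. h \<bullet> p)) (at y)"
  proof (rule has_derivativeI_sandwich[of 1])
    show "bounded_linear (\<lambda>h. h \<bullet> p)" by (rule bounded_linear_inner_left)
    show "((\<lambda>z. norm (z - y) / (2 * m)) \<longlongrightarrow> 0) (at y)"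
      using m by (auto intro!: tendsto_eq_intros)
    fix z assume "z \<noteq> y"
    have "\<bar>k z - k y - (z - y) \<bullet> p\<bar> \<le> (norm (z - y))\<^sup>2 / (2 * m)"
      using lower[of z] upper[of z] by (simp add: k ky inner_diff inner_commute)
    with \<open>z \<noteq> y\<close> m show "norm (k z - k y - (z - y) \<bullet> p) / norm (z - y) \<le> norm (z - y) / (2 * m)"
      by (simp add: divide_simps power2_eq_square)
  qed simp
  then show ?thesis
    unfolding has_egradient_def gderiv_def using fin by (simp add: k_def[abs_def])
qed

text \<open>With \<open>p\<close> the gradient of the conjugate at \<open>y\<close>, the subgradient
  inequality tested at the origin, where \<phi> vanishes, is exactly the claim.\<close>

lemma le_inner_egradient_conjugate:
  fixes \<phi> :: "'a::euclidean_space \<Rightarrow> ereal"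
  assumes "lsc \<phi>" and "m > 0" and "strongly_convex m \<phi>"
    and "\<And>x. \<phi> x \<ge> 0" and "\<phi> 0 = 0"
  shows "\<phi> (egradient (conjugate \<phi>) y) \<le> ereal (egradient (conjugate \<phi>) y \<bullet> y)"
proof -
  obtain p r where p: "\<phi> p = ereal r" "\<And>x. ereal (r + (x - p) \<bullet> y) \<le> \<phi> x"
    using subgradient_surj[OF assms, of y] by metis
  have "egradient (conjugate \<phi>) y = p"
    using has_egradient_conjugate[OF assms(2,3) p] by (rule egradient_eq)
  moreover have "r \<le> p \<bullet> y" using p(2)[of 0] assms(5) by (simp add: zero_ereal_def)
  ultimately show ?thesis using p(1) by simp
qed

text \<open>Gronwall with the integrating factor \<open>exp (\<mu> * s)\<close>: the product
  \<open>w\<close> is nonincreasing.\<close>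

lemma exp_decay_of_deriv_le:
  fixes v v' :: "real \<Rightarrow> real"
  assumes deriv: "\<And>t. t \<ge> 0 \<Longrightarrow> (v has_real_derivative v' t) (at t within {0..})"
    and le: "\<And>t. t \<ge> 0 \<Longrightarrow> v' t \<le> - \<mu> * v t" and "t \<ge> 0"
  shows "v t \<le> exp (- \<mu> * t) * v 0"
proof -
  define w where "w s = exp (\<mu> * s) * v s" for s
  have w: "(w has_real_derivative exp (\<mu> * s) * (\<mu> * v s + v' s)) (at s within {0..})" if "s \<ge> 0" for s
    unfolding w_def
    by (auto intro!: derivative_eq_intros deriv[OF that] simp: algebra_simps)
  have "w 0 \<ge> w t"
  \<comment> \<open>At 0 only a one-sided derivative is available, so the open-interval version is
    used, with mere continuity at the endpoints.\<close>
  proof (rule DERIV_nonpos_imp_decreasing_open[OF \<open>t \<ge> 0\<close>])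
    fix s :: real assume "0 < s" "s < t"
    have "(w has_real_derivative exp (\<mu> * s) * (\<mu> * v s + v' s)) (at s)"
      using w[of s] \<open>0 < s\<close> at_within_interior[of s "{0..}"] by simp
    moreover have "exp (\<mu> * s) * (\<mu> * v s + v' s) \<le> 0"
      using le[of s] \<open>0 < s\<close> by (simp add: mult_nonneg_nonpos)
    ultimately show "\<exists>d. (w has_real_derivative d) (at s) \<and> d \<le> 0" by blast
  next
    have "continuous_on {0..} w"
      by (rule DERIV_continuous_on[OF w]) simp
    then show "continuous_on {0..t} w" by (rule continuous_on_subset) auto
  qed
  then show ?thesis by (simp add: w_def exp_minus field_simps)
qed

theorem mainTheorem3:
  fixes f :: "real ^ 'n \<Rightarrow> real"
    and \<phi> :: "real ^ 'n \<Rightarrow> ereal"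
    and x0 :: "real ^ 'n"
    and x :: "real \<Rightarrow> real ^ 'n"
    and \<mu>\<^sub>\<phi> \<mu> :: real
  assumes "C2_function f" and "level_bounded f"
    and "proper_fun \<phi>" and "lsc \<phi>" and "essentially_smooth \<phi>"
    and "\<mu>\<^sub>\<phi> > 0" and "strongly_convex \<mu>\<^sub>\<phi> \<phi>"
    and "\<And>z. \<phi> z \<ge> 0" and "\<And>z. \<phi> (- z) = \<phi> z" and "\<phi> 0 = 0"
    and "preconditioned_flow f \<phi> x0 x"
    and "\<mu> > 0"
    and "\<And>z. \<phi> (egradient (conjugate \<phi>) (gradient f z)) \<ge> ereal (\<mu> * (f z - (INF w. f w)))"
  shows "\<forall>t\<ge>0. f (x t) - (INF w. f w) \<le> exp (- \<mu> * t) * (f x0 - (INF w. f w))"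
proof (intro allI impI)
  fix t :: real assume "t \<ge> 0"
  let ?c = "INF w. f w"
  let ?p = "\<lambda>s. egradient (conjugate \<phi>) (gradient f (x s))"
  obtain g where g: "\<And>z. GDERIV f z :> g z"
    using assms(1) unfolding C2_function_def by blast
  have gradf: "gradient f z = g z" for z using g by (rule gradient_eq)
  have x0: "x 0 = x0"
    and flow: "\<And>s. s \<ge> 0 \<Longrightarrow> (x has_vector_derivative - ?p s) (at s within {0..})"
    using assms(11) unfolding preconditioned_flow_def by auto
  have "f (x t) - ?c \<le> exp (- \<mu> * t) * (f (x 0) - ?c)"
  proof (rule exp_decay_of_deriv_le[of _ "\<lambda>s. - (?p s \<bullet> gradient f (x s))"])
    fix s :: real assume "s \<ge> 0"
    have "(f \<circ> x has_derivative (\<lambda>h. h \<bullet> g (x s)) \<circ> (\<lambda>h. h *\<^sub>R - ?p s)) (at s within {0..})"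
      using flow[OF \<open>s \<ge> 0\<close>] g[of "x s"] unfolding has_vector_derivative_def gderiv_def
      by (intro diff_chain_within) (auto intro: has_derivative_at_withinI)
    then have "((\<lambda>s. f (x s)) has_real_derivative - (?p s \<bullet> gradient f (x s))) (at s within {0..})"
      unfolding has_field_derivative_def
      by (auto simp: o_def gradf mult.commute elim!: has_derivative_eq_rhs)
    then show "((\<lambda>s. f (x s) - ?c) has_real_derivative - (?p s \<bullet> gradient f (x s)))
        (at s within {0..})"
      by (auto intro!: derivative_eq_intros)
    \<comment> \<open>The gradient dominance hypothesis bounds \<phi> at \<open>?p s\<close> from
      below, and the Fenchel-Young estimate bounds it from above by the dissipation rate of
      \<open>f\<close> along the flow.\<close>
    have "ereal (\<mu> * (f (x s) - ?c)) \<le> ereal (?p s \<bullet> gradient f (x s))"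
      using assms(13)[of "x s"]
        le_inner_egradient_conjugate[OF assms(4,6,7,8,10), of "gradient f (x s)"]
      by (rule order_trans)
    then show "- (?p s \<bullet> gradient f (x s)) \<le> - \<mu> * (f (x s) - ?c)" by simp
  qed (fact \<open>t \<ge> 0\<close>)
  with x0 show "f (x t) - ?c \<le> exp (- \<mu> * t) * (f x0 - ?c)" by simp
qed

end
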